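(* Let $T$ be a tree on $n$ vertices $1,2,\ldots,n$ with $n\ge2$. Let $\lambda_1<\mu_1<\lambda_2<\cdots<\mu_{n-1}<\lambda_n$ be $2n-1$ real numbers such that $\lambda_j=-\lambda_{n+1-j}$ for all $j=1,\ldots,n$, and $\mu_k=-\mu_{n-k}$ for all $k=1,\ldots,n-1$. If $T$ is NEB at a vertex $v$, then there exists a skew-symmetric matrix $A\in S^-(T)$ with eigenvalues $\mathrm{i}\lambda_1,\mathrm{i}\lambda_2,\ldots,\mathrm{i}\lambda_n$ such that the eigenvalues of $A(v)$ are $\mathrm{i}\mu_1,\mathrm{i}\mu_2,\ldots,\mathrm{i}\mu_{n-1}$.
   Context: $\mathrm{i}=\sqrt{-1}$. For a real skew-symmetric matrix $A=[a_{i,j}]$ of order $n$, its graph $G(A)$ has vertex set $\{1,\ldots,n\}$ and edge set $\{\{i,j\}: a_{i,j}\ne 0,\ i<j\}$. $S^-(T)$ is the set of all real skew-symmetric matrices whose graph is $T$. $A(v)$ is the principal submatrix of $A$ obtained by deleting row and column $v$. For a vertex $w$ of a tree $T$, $T(w)$ is the forest obtained by deleting $w$; for a neighbor $u$ of $w$, $T_u(w)$ is the connected component of $T(w)$ containing $u$. NEB (nearly even branching; recursive): let $T$ be a tree on $n$ vertices and $w$ a vertex of $T$. If $n=1$, $T$ is NEB at $w$. If $n\ge2$, $T$ is NEB at $w$ if (i) $T(w)$ has exactly one odd component (a connected component with an odd number of vertices) when $n$ is even, and no odd component when $n$ is odd; and (ii) for each neighbor $u$ of $w$ in $T$, $T_u(w)$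 is NEB at $u$. *)

theory Defs
  imports
    "Jordan_Normal_Form.Spectral_Radius"
    "Graph_Theory.Graph_Theory"
begin

text \<open>
  A finite simple graph is a symmetric digraph in the sense of the locale \<^locale>\<open>graph\<close>:
  each undirected edge is a pair of opposite arcs. The library's \<^const>\<open>Digraph_Component.tree\<close>
  is not usable for such graphs, because there the walk \<open>a, b, a\<close> along a single edge counts as a
  cycle. The cycles of the undirected graph are the directed cycles of length at least 3.
\<close>

definition undirected_tree :: "('a, 'b) pre_digraph \<Rightarrow> bool" where
  "undirected_tree G \<longleftrightarrow>
     graph G \<and> Digraph_Component.connected G \<and> (\<nexists>p. pre_digraph.cycle G p \<and> 3 \<le> length p)"

text \<open>In a symmetric digraph the strongly connected components are the connected components.\<close>

definition odd_components :: "('a, 'b) pre_digraph \<Rightarrow> 'a set set" where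
  "odd_components G = {C \<in> pre_digraph.sccs_verts G. odd (card C)}"

text \<open>\<open>branch_at T w u\<close> is the graph $T_u(w)$.\<close>

definition branch_at :: "('a, 'b) pre_digraph \<Rightarrow> 'a \<Rightarrow> 'a \<Rightarrow> ('a, 'b) pre_digraph" where
  "branch_at T w u =
     induce_subgraph (pre_digraph.del_vert T w) (pre_digraph.scc_of (pre_digraph.del_vert T w) u)"

text \<open>
  \<open>NEB T w\<close>: \<open>T\<close> is nearly even branching at \<open>w\<close>. The recursion is well-founded, since the
  branches have fewer vertices, so the least fixed point is the recursively defined notion.
\<close>

inductive NEB :: "('a, 'b) pre_digraph \<Rightarrow> 'a \<Rightarrow> bool" where
  NEB_single:
    "\<lbrakk>undirected_tree T; verts T = {w}\<rbrakk> \<Longrightarrow> NEB T w"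
| NEB_branch:
    "\<lbrakk>undirected_tree T; w \<in> verts T; 2 \<le> card (verts T);
      even (card (verts T)) \<Longrightarrow> card (odd_components (pre_digraph.del_vert T w)) = 1;
      odd (card (verts T)) \<Longrightarrow> odd_components (pre_digraph.del_vert T w) = {};
      \<And>u. w \<rightarrow>\<^bsub>T\<^esub> u \<Longrightarrow> NEB (branch_at T w u) u\<rbrakk> \<Longrightarrow> NEB T w"

definition skew_symmetric_mat :: "real mat \<Rightarrow> bool" where
  "skew_symmetric_mat A \<longleftrightarrow> square_mat A \<and> transpose_mat A = - A"

text \<open>
  Vertices are the matrix indices \<open>0, \<dots>, n - 1\<close> instead of \<open>1, \<dots>, n\<close>.
\<close>

definition graph_of_mat :: "real mat \<Rightarrow> nat pair_pre_digraph" where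
  "graph_of_mat A =
     (let E = {(i, j). i < j \<and> j < dim_row A \<and> A $$ (i, j) \<noteq> 0}
      in \<lparr> pverts = {..<dim_row A}, parcs = E \<union> converse E \<rparr>)"

text \<open>The set $S^-(T)$.\<close>

definition skew_mats_of_graph :: "nat pair_pre_digraph \<Rightarrow> real mat set" where
  "skew_mats_of_graph T = {A. skew_symmetric_mat A \<and> graph_of_mat A = T}"

end

theory Submission
  imports Defs "HOL-Computational_Algebra.Fundamental_Theorem_Algebra"
begin

text \<open>
  Let \<open>p\<close> and \<open>q\<close> be the monic polynomials with roots \<open>\<lambda>\<^sub>j\<close> and \<open>\<mu>\<^sub>k\<close>. Interlacing means that \<open>q / p\<close> is
  a sum of terms \<open>c\<^sub>j / (x - \<lambda>\<^sub>j)\<close> with all \<open>c\<^sub>j > 0\<close>, and then \<open>p / q = x - (\<Sum>k. d\<^sub>k / (x - \<mu>\<^sub>k))\<close> with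
  all \<open>d\<^sub>k > 0\<close>; the reflection \<open>x \<mapsto> - x\<close> preserves the coefficients and kills the constant term.
  The NEB condition says exactly that the \<open>\<mu>\<^sub>k\<close> can be split into reflection-invariant groups of the
  sizes of the branches at \<open>v\<close>: even branches take pairs \<open>\<plusminus> \<mu>\<^sub>k\<close>, the odd branch, if any, takes \<open>0\<close> as well.
  The partial sum over the group of a branch is a positive multiple of a quotient of the same kind as
  \<open>q / p\<close>, to which the construction applies recursively; the square root of that multiple is the
  entry of the edge joining the branch to \<open>v\<close>. Determinants are avoided by constructing
  eigenvectors along the recursion; as the prescribed eigenvalues are distinct, they exhaust the spectrum.
\<close>

section \<open>Partial fractions with positive coefficients\<close>

definition node_poly :: "'a::field set \<Rightarrow> 'a poly" where
  "node_poly S = (\<Prod>s\<in>S. [:- s, 1:])"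

text \<open>The numerator of the partial fraction sum of \<open>c s / (x - s)\<close> over the
  common denominator \<open>node_poly S\<close>.\<close>

definition weighted_poly :: "'a::field set \<Rightarrow> ('a \<Rightarrow> 'a) \<Rightarrow> 'a poly" where
  "weighted_poly S c = (\<Sum>s\<in>S. Polynomial.smult (c s) (node_poly (S - {s})))"

lemma poly_node_poly: "poly (node_poly S) x = (\<Prod>s\<in>S. x - s)"
  by (simp add: node_poly_def poly_prod)

lemma poly_weighted_poly: "poly (weighted_poly S c) x = (\<Sum>s\<in>S. c s * (\<Prod>t\<in>S - {s}. x - t))"
  by (simp add: weighted_poly_def poly_sum poly_node_poly)

lemma poly_node_poly_eq_0_iff: "finite S \<Longrightarrow> poly (node_poly S) x = 0 \<longleftrightarrow> x \<in> S"
  by (auto simp: poly_node_poly)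

lemma degree_node_poly [simp]: "degree (node_poly S) = card S"
  unfolding node_poly_def by (subst degree_prod_sum_eq) auto

lemma coeff_node_poly_card [simp]: "coeff (node_poly S) (card S) = 1"
  using lead_coeff_prod[of "\<lambda>s. [:- s, 1:]" S] degree_node_poly[of S]
  by (simp add: node_poly_def)

lemma node_poly_neq_0 [simp]: "node_poly S \<noteq> 0"
proof
  assume "node_poly S = 0"
  then have "coeff (node_poly S) (card S) = 0" by (simp only: coeff_0)
  then show False by simp
qed

lemma node_poly_remove:
  "finite S \<Longrightarrow> s \<in> S \<Longrightarrow> node_poly S = [:- s, 1:] * node_poly (S - {s})"
  unfolding node_poly_def by (rule prod.remove)

lemma degree_weighted_poly_le: "finite S \<Longrightarrow> degree (weighted_poly S c) \<le> card S - 1"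
  unfolding weighted_poly_def by (rule degree_sum_le) auto

lemma coeff_weighted_poly:
  assumes "finite S"
  shows "coeff (weighted_poly S c) (card S - 1) = (\<Sum>s\<in>S. c s)"
proof -
  have "coeff (node_poly (S - {s})) (card S - 1) = 1" if "s \<in> S" for s
    using coeff_node_poly_card[of "S - {s}"] that assms by simp
  then show ?thesis by (simp add: weighted_poly_def coeff_sum)
qed

lemma poly_weighted_poly_node:
  assumes "finite S" "s \<in> S"
  shows "poly (weighted_poly S c) s = c s * poly (node_poly (S - {s})) s"
proof -
  have "poly (weighted_poly S c) s = (\<Sum>t\<in>S. if t = s then c s * poly (node_poly (S - {s})) s else 0)"
    unfolding weighted_poly_def poly_sum poly_smult
  proof (rule sum.cong)
    fix t assume "t \<in> S"
    have "poly (node_poly (S - {t})) s = 0" if "t \<noteq> s"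
      using that assms by (subst poly_node_poly_eq_0_iff) auto
    then show "c t * poly (node_poly (S - {t})) s =
        (if t = s then c s * poly (node_poly (S - {s})) s else 0)" by auto
  qed simp
  then show ?thesis using assms by simp
qed

text \<open>Both sides have degree below \<open>card S\<close> and agree on \<open>S\<close>. The
  degree bound is phrased with coefficients so that it forces \<open>r = 0\<close> when
  \<open>S\<close> is empty, where a strict bound on \<open>degree r\<close> could not hold.\<close>

lemma lagrange_interpolation:
  assumes "finite S" and "\<And>i. i \<ge> card S \<Longrightarrow> coeff r i = 0"
  shows "r = weighted_poly S (\<lambda>s. poly r s / poly (node_poly (S - {s})) s)"
proof (cases "S = {}")
  case True
  with assms show ?thesis by (auto simp: weighted_poly_def poly_eq_iff)
next
  case False
  then have pos: "card S > 0" using assms(1) by auto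
  show ?thesis
  proof (rule poly_eqI_degree[where A = S])
    show "card S > degree r"
    proof (cases "r = 0")
      case False
      then have "\<not> card S \<le> degree r" using assms(2)[of "degree r"] by auto
      then show ?thesis by linarith
    qed (use pos in simp)
    show "card S > degree (weighted_poly S (\<lambda>s. poly r s / poly (node_poly (S - {s})) s))"
      by (rule le_less_trans[OF degree_weighted_poly_le[OF assms(1)]]) (use pos in simp)
    fix s assume "s \<in> S"
    moreover have "poly (node_poly (S - {s})) s \<noteq> 0"
      using assms(1) by (subst poly_node_poly_eq_0_iff) auto
    ultimately show "poly r s = poly (weighted_poly S (\<lambda>s. poly r s / poly (node_poly (S - {s})) s)) s"
      by (subst poly_weighted_poly_node[OF assms(1)]) auto
  qed
qed

text \<open>The derivative of the sum of \<open>c s / (x - s)\<close> is minus the sum of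
  \<open>c s / (x - s)^2\<close>; multiplying by the square of \<open>node_poly S\<close> gives a
  polynomial identity. For nonempty \<open>S\<close> and positive weights the Wronskian is therefore
  negative on the real line.\<close>

lemma weighted_poly_wronskian:
  fixes S :: "'a::field set"
  assumes "finite S"
  shows "pderiv (weighted_poly S c) * node_poly S - weighted_poly S c * pderiv (node_poly S)
    = - (\<Sum>s\<in>S. Polynomial.smult (c s) ((node_poly (S - {s}))\<^sup>2))"
proof -
  have *: "pderiv (node_poly (S - {s})) * node_poly S - node_poly (S - {s}) * pderiv (node_poly S)
      = - ((node_poly (S - {s}))\<^sup>2)" if "s \<in> S" for s
  proof -
    define N where "N = node_poly (S - {s})"
    have eq: "node_poly S = [:- s, 1:] * N"
      unfolding N_def by (rule node_poly_remove[OF assms that])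
    have "pderiv [:- s, 1:] = 1" by (simp add: pderiv_pCons)
    then have deq: "pderiv (node_poly S) = [:- s, 1:] * pderiv N + N"
      by (simp only: eq pderiv_mult mult_1_right)
    have "D * (X * N) - N * (X * D + N) = - (N\<^sup>2)" for X D :: "'a poly"
      by (simp add: power2_eq_square algebra_simps)
    then show ?thesis
      unfolding N_def[symmetric] deq unfolding eq .
  qed
  have "pderiv (weighted_poly S c) * node_poly S - weighted_poly S c * pderiv (node_poly S)
     = (\<Sum>s\<in>S. Polynomial.smult (c s) (pderiv (node_poly (S - {s})) * node_poly S
          - node_poly (S - {s}) * pderiv (node_poly S)))"
    unfolding weighted_poly_def
    by (simp add: pderiv_sum pderiv_smult sum_distrib_right sum_subtractf smult_diff_right)
  also have "\<dots> = (\<Sum>s\<in>S. Polynomial.smult (c s) (- ((node_poly (S - {s}))\<^sup>2)))"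
    by (rule sum.cong) (auto simp: *)
  finally show ?thesis by (simp add: sum_negf)
qed

section \<open>Parity under the reflection x \<mapsto> - x\<close>

lemma poly_node_poly_reflect:
  "poly (node_poly (uminus ` S)) (- x) = (- 1) ^ card S * poly (node_poly S) x"
proof -
  have "poly (node_poly (uminus ` S)) (- x) = (\<Prod>s\<in>S. - x - - s)"
    unfolding poly_node_poly by (subst prod.reindex) auto
  also have "\<dots> = (\<Prod>s\<in>S. (- 1) * (x - s))"
    by (rule prod.cong) auto
  also have "\<dots> = (- 1) ^ card S * (\<Prod>s\<in>S. x - s)"
    by (subst prod.distrib) simp
  finally show ?thesis by (simp add: poly_node_poly)
qed

lemma poly_node_poly_remove_reflect:
  assumes "uminus ` S = S"
  shows "poly (node_poly (S - {- s})) (- x) = (- 1) ^ card (S - {s}) * poly (node_poly (S - {s})) x"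
proof -
  have "uminus ` (S - {s}) = S - {- s}"
    using assms by (subst image_set_diff) auto
  then show ?thesis using poly_node_poly_reflect[of "S - {s}" x] by simp
qed

lemma poly_weighted_poly_reflect:
  assumes "finite S" "uminus ` S = S" and "\<And>s. s \<in> S \<Longrightarrow> c (- s) = c s"
  shows "poly (weighted_poly S c) (- x) = (- 1) ^ (card S - 1) * poly (weighted_poly S c) x"
proof -
  have "poly (weighted_poly S c) (- x) = (\<Sum>s\<in>uminus ` S. c s * poly (node_poly (S - {s})) (- x))"
    by (simp add: assms weighted_poly_def poly_sum)
  also have "\<dots> = (\<Sum>s\<in>S. c s * poly (node_poly (S - {- s})) (- x))"
    by (subst sum.reindex) (auto simp: assms)
  also have "\<dots> = (\<Sum>s\<in>S. c s * ((- 1) ^ (card S - 1) * poly (node_poly (S - {s})) x))"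
    using assms by (intro sum.cong) (auto simp: poly_node_poly_remove_reflect)
  also have "\<dots> = (- 1) ^ (card S - 1) * poly (weighted_poly S c) x"
    by (simp add: weighted_poly_def poly_sum sum_distrib_left mult.left_commute)
  finally show ?thesis .
qed

lemma uminus_image_eq_iff:
  fixes S :: "'a::group_add set"
  shows "uminus ` S = S \<longleftrightarrow> (\<forall>s\<in>S. - s \<in> S)"
proof
  assume *: "\<forall>s\<in>S. - s \<in> S"
  then have "s \<in> uminus ` S" if "s \<in> S" for s
    using that by (intro image_eqI[of _ _ "- s"]) auto
  with * show "uminus ` S = S" by auto
qed auto

text \<open>On \<open>\<real>\<close>, the Wronskian identity makes the roots simple; off \<open>\<real>\<close>, the number
  \<open>weighted_poly S c * cnj (node_poly S)\<close> has nonzero imaginary part.\<close>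

lemma weighted_poly_real_rooted:
  fixes S :: "real set"
  assumes "finite S" "S \<noteq> {}" and pos: "\<And>s. s \<in> S \<Longrightarrow> c s > 0" and "(\<Sum>s\<in>S. c s) = 1"
  shows "\<exists>R. finite R \<and> card R = card S - 1 \<and> weighted_poly S c = node_poly R"
proof -
  \<comment> \<open>The same polynomial over the complex numbers; the weights are read off through
    \<open>Re\<close>, so that the general lemmas apply to the embedded nodes.\<close>
  define Q where "Q = weighted_poly (complex_of_real ` S) (\<lambda>z. of_real (c (Re z)))"
  have fin: "finite (complex_of_real ` S)" using assms(1) by simp
  have inj: "inj_on complex_of_real A" for A by (auto intro: inj_onI)
  have diff: "complex_of_real ` S - {complex_of_real s} = complex_of_real ` (S - {s})" for s
    by auto
  have Q: "poly Q z = (\<Sum>s\<in>S. of_real (c s) * (\<Prod>t\<in>S - {s}. z - of_real t))" for z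
    unfolding Q_def poly_weighted_poly
    by (simp add: sum.reindex[OF inj] diff prod.reindex[OF inj] o_def)
  have Qr: "poly Q (of_real x) = of_real (poly (weighted_poly S c) x)" for x
    unfolding Q poly_weighted_poly by simp
  have card: "card (complex_of_real ` S) = card S" by (rule card_image[OF inj])
  have "coeff Q (card S - 1) = 1"
    using coeff_weighted_poly[OF fin, of "\<lambda>z. of_real (c (Re z))"] assms(4)
    by (simp add: Q_def card sum.reindex[OF inj] o_def flip: of_real_sum)
  moreover have "degree Q \<le> card S - 1"
    using degree_weighted_poly_le[OF fin] by (simp add: Q_def card)
  ultimately have lc: "lead_coeff Q = 1" and deg: "degree Q = card S - 1"
    using le_degree[of Q "card S - 1"] by auto
  \<comment> \<open>The sum is minus the Wronskian at \<open>x\<close>. If \<open>x\<close> is a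
    node, its own summand is the nonzero one; otherwise every summand is positive.\<close>
  have wneg: "(\<Sum>s\<in>S. c s * (\<Prod>t\<in>S - {s}. x - t)\<^sup>2) > 0" for x
  proof -
    obtain s where s: "s \<in> S" "x \<in> S \<longrightarrow> x = s" using assms(2) by (cases "x \<in> S") auto
    then have "(\<Prod>t\<in>S - {s}. x - t) \<noteq> 0" using assms(1) by auto
    with s show ?thesis
      using pos assms(1)
      by (intro sum_pos2[where i = s]) (auto intro!: mult_nonneg_nonneg less_imp_le[OF pos])
  qed
  have real: "Im z = 0" if "poly Q z = 0" for z
  proof (rule ccontr)
    assume im: "Im z \<noteq> 0"
    then have nz: "z - of_real s \<noteq> 0" for s by auto
    define N where "N s = (\<Prod>t\<in>S - {s}. z - of_real t)" for s
    have N: "N s \<noteq> 0" for s using nz assms(1) by (auto simp: N_def)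
    have P: "(\<Prod>t\<in>S. z - of_real t) = (z - of_real s) * N s" if "s \<in> S" for s
      unfolding N_def by (rule prod.remove[OF assms(1) that])
    \<comment> \<open>Each term is a positive multiple of \<open>cnj (z - of_real s)\<close>, whose
      imaginary part is \<open>- Im z\<close> for every \<open>s\<close>, so the imaginary parts
      cannot cancel.\<close>
    have "0 = poly Q z * cnj (\<Prod>t\<in>S. z - of_real t)" using that by simp
    also have "\<dots> = (\<Sum>s\<in>S. of_real (c s) * (N s * cnj ((z - of_real s) * N s)))"
      unfolding Q N_def[symmetric] sum_distrib_right
      by (rule sum.cong) (auto simp: P)
    also have "\<dots> = (\<Sum>s\<in>S. of_real (c s * (cmod (N s))\<^sup>2) * cnj (z - of_real s))"
      by (rule sum.cong) (simp_all add: complex_norm_square mult_ac del: of_real_power complex_cnj_diff)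
    finally have "0 = Im (\<Sum>s\<in>S. of_real (c s * (cmod (N s))\<^sup>2) * cnj (z - of_real s))" by simp
    also have "\<dots> = - Im z * (\<Sum>s\<in>S. c s * (cmod (N s))\<^sup>2)"
      by (simp add: sum_distrib_left sum_negf mult.commute)
    finally have "(\<Sum>s\<in>S. c s * (cmod (N s))\<^sup>2) = 0" using im by simp
    moreover have "(\<Sum>s\<in>S. c s * (cmod (N s))\<^sup>2) > 0"
      using pos N assms(1,2) by (intro sum_pos) auto
    ultimately show False by simp
  qed
  have "rsquarefree Q"
    unfolding rsquarefree_roots
  proof (intro allI notI)
    \<comment> \<open>A common zero of \<open>Q\<close> and its derivative is a zero of the
      Wronskian; being real, it contradicts \<open>wneg\<close>.\<close>
    fix z assume z: "poly Q z = 0 \<and> poly (pderiv Q) z = 0"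
    define x where "x = Re z"
    have zx: "z = of_real x" using z real[of z] by (simp add: x_def complex_eq_iff)
    have "poly (\<Sum>s\<in>complex_of_real ` S. Polynomial.smult (of_real (c (Re s)))
        ((node_poly (complex_of_real ` S - {s}))\<^sup>2)) z = 0"
      using arg_cong[OF weighted_poly_wronskian[OF fin, of "\<lambda>z. of_real (c (Re z))"], of "\<lambda>p. poly p z"] z
      by (simp add: Q_def)
    also have "poly (\<Sum>s\<in>complex_of_real ` S. Polynomial.smult (of_real (c (Re s)))
        ((node_poly (complex_of_real ` S - {s}))\<^sup>2)) z
      = of_real (\<Sum>s\<in>S. c s * (\<Prod>t\<in>S - {s}. x - t)\<^sup>2)"
      by (simp add: sum.reindex[OF inj] diff prod.reindex[OF inj] o_def poly_sum poly_power poly_node_poly zx)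
    finally show False using wneg[of x] by (simp only: of_real_eq_0_iff)
  qed
  then have "node_poly {z. poly Q z = 0} = Q"
    using complex_poly_decompose_rsquarefree[of Q] by (simp add: lc node_poly_def)
  moreover define R where "R = {x. poly (weighted_poly S c) x = 0}"
  have roots: "{z. poly Q z = 0} = complex_of_real ` R"
  proof (intro equalityI subsetI)
    fix z assume z: "z \<in> {z. poly Q z = 0}"
    then have zr: "z = of_real (Re z)" using real[of z] by (simp add: complex_eq_iff)
    have "of_real (poly (weighted_poly S c) (Re z)) = (0 :: complex)"
      using z unfolding Qr[symmetric] zr[symmetric] by simp
    then show "z \<in> complex_of_real ` R"
      using zr by (intro image_eqI[of _ _ "Re z"]) (simp_all add: R_def)
  qed (auto simp: R_def Qr)
  ultimately have QR: "node_poly (complex_of_real ` R) = Q" by simp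
  have "Q \<noteq> 0" using lc by auto
  then have "finite (complex_of_real ` R)" using poly_roots_finite[of Q] roots by simp
  then have "finite R" using finite_imageD inj by blast
  moreover have "card R = card S - 1"
    using degree_node_poly[of "complex_of_real ` R"] by (simp add: QR deg card_image[OF inj])
  moreover have "weighted_poly S c = node_poly R"
  proof (rule poly_eq_poly_eq_iff[THEN iffD1], rule ext)
    fix x
    have "complex_of_real (poly (node_poly R) x) = poly Q (of_real x)"
      unfolding QR[symmetric] poly_node_poly by (simp add: prod.reindex[OF inj] o_def)
    then show "poly (weighted_poly S c) x = poly (node_poly R) x"
      unfolding Qr by simp
  qed
  ultimately show ?thesis by blast
qed

text \<open>One step of the continued fraction of \<open>p / q\<close>, where
  \<open>p = node_poly L\<close> and \<open>q = weighted_poly L c\<close>. The reflection removes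
  the constant term of the linear quotient, and the remainder is interpolated at the roots
  \<open>M\<close> of \<open>q\<close>. Its weights are \<open>d m = - p(m) / q'(m)\<close>,
  positive because the Wronskian \<open>q' p - q p'\<close> is negative.\<close>

lemma node_poly_division_step:
  fixes L :: "real set"
  assumes "finite L" "L \<noteq> {}" "uminus ` L = L"
    and pos: "\<And>l. l \<in> L \<Longrightarrow> c l > 0" and sym: "\<And>l. l \<in> L \<Longrightarrow> c (- l) = c l"
    and sum: "(\<Sum>l\<in>L. c l) = 1"
  obtains M d where "finite M" "card M = card L - 1" "uminus ` M = M"
    "\<And>m. m \<in> M \<Longrightarrow> d m > 0" "\<And>m. m \<in> M \<Longrightarrow> d (- m) = d m"
    "weighted_poly L c = node_poly M"
    "node_poly L = [:0, 1:] * node_poly M - weighted_poly M d"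
proof -
  obtain M where M: "finite M" "card M = card L - 1" "weighted_poly L c = node_poly M"
    using weighted_poly_real_rooted[OF assms(1,2) pos sum] by blast
  have cL: "card L = Suc (card M)" using M(2) assms(1,2) by (simp add: card_gt_0_iff)
  have reflM: "poly (node_poly M) (- x) = (- 1) ^ card M * poly (node_poly M) x" for x
    using poly_weighted_poly_reflect[where c = c, OF assms(1,3) sym] by (simp add: M(2,3))
  have symM: "uminus ` M = M"
    unfolding uminus_image_eq_iff
  proof
    fix m assume "m \<in> M"
    then have "poly (node_poly M) (- m) = 0" unfolding reflM using poly_node_poly_eq_0_iff[OF M(1)] by simp
    then show "- m \<in> M" using poly_node_poly_eq_0_iff[OF M(1)] by simp
  qed
  have reflL: "poly (node_poly L) (- x) = (- 1) ^ card L * poly (node_poly L) x" for x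
    using poly_node_poly_reflect[of L x] assms(3) by simp
  define r where "r = [:0, 1:] * node_poly M - node_poly L"
  \<comment> \<open>The two leading terms cancel in degree \<open>card L\<close>; \<open>r\<close>
    has the parity of \<open>card L\<close>, so its coefficient one degree lower, at
    \<open>card M\<close>, vanishes as well.\<close>
  have coeff0: "coeff r i = 0" if "i \<ge> card M" for i
  proof -
    have "degree ([:0, 1:] * node_poly M) = card L"
      using cL by (subst degree_mult_eq) auto
    then have "coeff r i = 0" if "i > card L"
      using that by (simp add: r_def coeff_eq_0)
    moreover have "coeff r (card L) = 0"
      by (simp add: r_def cL coeff_pCons) (metis cL coeff_node_poly_card)
    moreover have "coeff r (card M) = 0"
    proof -
      have "pcompose r [:0, - 1:] = Polynomial.smult ((- 1) ^ card L) r"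
        by (rule poly_eq_poly_eq_iff[THEN iffD1])
          (auto simp: poly_pcompose r_def reflM reflL cL algebra_simps)
      then have "(- 1) ^ card M * coeff r (card M) = (- 1) ^ card L * coeff r (card M)"
        by (metis coeff_pcompose_linear coeff_smult)
      then show ?thesis by (simp add: cL)
    qed
    moreover have "i = card M \<or> i = card L \<or> i > card L" using that cL by linarith
    ultimately show ?thesis by blast
  qed
  define d where "d m = poly r m / poly (node_poly (M - {m})) m" for m
  have lag: "r = weighted_poly M d"
    unfolding d_def by (rule lagrange_interpolation[OF M(1) coeff0])
  have dM: "d m = - poly (node_poly L) m / poly (node_poly (M - {m})) m" if "m \<in> M" for m
    using that M(1) poly_node_poly_eq_0_iff[of M m] by (simp add: d_def r_def)
  have "d m > 0" if m: "m \<in> M" for m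
  proof -
    have "[:- m, 1:] * node_poly (M - {m}) = node_poly M"
      using node_poly_remove[OF M(1) m] by simp
    then have "pderiv (node_poly M) = [:- m, 1:] * pderiv (node_poly (M - {m})) + node_poly (M - {m}) * pderiv [:- m, 1:]"
      by (metis pderiv_mult)
    then have der: "poly (pderiv (node_poly M)) m = poly (node_poly (M - {m})) m"
      by (simp add: pderiv_pCons)
    have nm: "poly (node_poly M) m = 0" using m M(1) poly_node_poly_eq_0_iff by blast
    \<comment> \<open>At a node of \<open>L\<close> the divisor takes the value of the weight times
      a nonzero product, so it has no root in \<open>L\<close>.\<close>
    have "m \<notin> L"
    proof
      assume "m \<in> L"
      then have "poly (weighted_poly L c) m = c m * poly (node_poly (L - {m})) m"
        by (rule poly_weighted_poly_node[OF assms(1)])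
      moreover have "poly (node_poly (L - {m})) m \<noteq> 0"
        using assms(1) by (subst poly_node_poly_eq_0_iff) auto
      ultimately show False using pos[OF \<open>m \<in> L\<close>] nm M(3) by simp
    qed
    then have nz: "poly (node_poly (L - {l})) m \<noteq> 0" for l
      using assms(1) by (subst poly_node_poly_eq_0_iff) auto
    have "poly (node_poly (M - {m})) m * poly (node_poly L) m
        = - (\<Sum>l\<in>L. c l * (poly (node_poly (L - {l})) m)\<^sup>2)"
      using arg_cong[OF weighted_poly_wronskian[OF assms(1), of c], of "\<lambda>p. poly p m"]
      by (simp add: M(3) der nm poly_sum poly_power)
    moreover have "(\<Sum>l\<in>L. c l * (poly (node_poly (L - {l})) m)\<^sup>2) > 0"
      using nz pos assms(1,2) by (intro sum_pos) auto
    ultimately have "poly (node_poly (M - {m})) m * poly (node_poly L) m < 0" by simp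
    then show ?thesis unfolding dM[OF m] by (auto simp: mult_less_0_iff zero_less_divide_iff divide_neg_pos divide_pos_neg)
  qed
  moreover have "d (- m) = d m" if m: "m \<in> M" for m
  proof -
    have m': "- m \<in> M" using m symM by (metis imageI)
    have "card (M - {m}) = card M - 1" "card M > 0" using m M(1) by (auto simp: card_gt_0_iff)
    \<comment> \<open>\<open>card L\<close> exceeds \<open>card (M - {m})\<close> by two, so
      numerator and denominator of \<open>d m\<close> pick up the same sign.\<close>
    then have "(- 1 :: real) ^ card L = (- 1) ^ card (M - {m})"
      unfolding cL by (cases "card M") auto
    then show ?thesis
      unfolding dM[OF m] dM[OF m'] poly_node_poly_remove_reflect[OF symM] reflL by simp
  qed
  moreover have "node_poly L = [:0, 1:] * node_poly M - weighted_poly M d"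
    unfolding lag[symmetric] by (simp add: r_def)
  ultimately show thesis using that[of M d] M symM by blast
qed

section \<open>Partitions into symmetric sets\<close>

lemma even_card_symmetric:
  fixes S :: "real set"
  assumes "finite S" "uminus ` S = S" "0 \<notin> S"
  shows "card S = 2 * card {s \<in> S. s > 0}"
proof -
  have neg: "{s \<in> S. s < 0} = uminus ` {s \<in> S. s > 0}"
  proof (intro equalityI subsetI)
    fix s assume "s \<in> {s \<in> S. s < 0}"
    then show "s \<in> uminus ` {s \<in> S. s > 0}"
      using assms(2) by (intro image_eqI[of _ _ "- s"]) (auto simp: uminus_image_eq_iff)
  qed (use assms(2) in \<open>auto simp: uminus_image_eq_iff\<close>)
  have "card S = card ({s \<in> S. s > 0} \<union> {s \<in> S. s < 0})"
  proof (rule arg_cong[of _ _ card], intro equalityI subsetI)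
    fix s assume "s \<in> S"
    then show "s \<in> {s \<in> S. s > 0} \<union> {s \<in> S. s < 0}"
      using assms(3) by (cases s "0 :: real" rule: linorder_cases) auto
  qed auto
  also have "\<dots> = card {s \<in> S. s > 0} + card {s \<in> S. s < 0}"
    using assms(1) by (intro card_Un_disjoint) auto
  finally have "card S = card {s \<in> S. s > 0} + card {s \<in> S. s < 0}" .
  then show ?thesis unfolding neg by (simp add: card_image)
qed

text \<open>Negation pairs off the nonzero elements; only \<open>0\<close> is its own
  partner.\<close>

lemma odd_card_symmetric_iff:
  fixes S :: "real set"
  assumes "finite S" "uminus ` S = S"
  shows "odd (card S) \<longleftrightarrow> 0 \<in> S"
proof (cases "0 \<in> S")
  case True
  have "uminus ` (S - {0}) = S - {0}"
    using assms(2) by (auto simp: uminus_image_eq_iff)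
  then have "even (card (S - {0}))"
    using even_card_symmetric[of "S - {0}"] assms(1) by simp
  with True card.remove[OF assms(1) True] show ?thesis by (metis even_Suc)
next
  case False
  then show ?thesis using even_card_symmetric[OF assms] by simp
qed

text \<open>Take \<open>m div 2\<close> positive elements together with their negatives, and
  \<open>0\<close> in addition if \<open>m\<close> is odd; the parity hypothesis makes
  \<open>0\<close> available in that case.\<close>

lemma obtain_symmetric_subset:
  fixes S :: "real set"
  assumes "finite S" "uminus ` S = S" "m \<le> card S" "odd m \<longrightarrow> odd (card S)"
  obtains A where "A \<subseteq> S" "uminus ` A = A" "card A = m"
proof -
  define P where "P = {s \<in> S. s > 0}"
  have "uminus ` (S - {0}) = S - {0}"
    using assms(2) by (auto simp: uminus_image_eq_iff)
  moreover have "{s \<in> S - {0}. s > 0} = P" by (auto simp: P_def)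
  ultimately have card: "card (S - {0}) = 2 * card P"
    using even_card_symmetric[of "S - {0}"] assms(1) by simp
  have "m div 2 \<le> card P"
  proof (cases "0 \<in> S")
    case True
    have "card S = Suc (2 * card P)" using card.remove[OF assms(1) True] card by (simp only:)
    then show ?thesis using assms(3) by simp
  next
    case False
    then show ?thesis using assms(3) card by simp
  qed
  then obtain B where B: "B \<subseteq> P" "card B = m div 2" "finite B"
    by (meson obtain_subset_with_card_n)
  have symB: "uminus ` (B \<union> uminus ` B) = B \<union> uminus ` B"
    by (auto simp: image_Un image_image)
  have sub: "B \<union> uminus ` B \<subseteq> S - {0}"
    using B(1) assms(2) by (auto simp: P_def uminus_image_eq_iff)
  have "\<forall>s\<in>B. s > 0" using B(1) by (auto simp: P_def)
  then have "- s \<notin> B" if "s \<in> B" for s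
    using that by (metis neg_0_less_iff_less less_asym)
  then have "B \<inter> uminus ` B = {}" by auto
  then have cB: "card (B \<union> uminus ` B) = 2 * (m div 2)"
    using B by (simp add: card_Un_disjoint card_image)
  show thesis
  proof (cases "odd m")
    case True
    with assms have "0 \<in> S" using odd_card_symmetric_iff by blast
    show ?thesis
    proof (rule that)
      show "insert 0 (B \<union> uminus ` B) \<subseteq> S" using sub \<open>0 \<in> S\<close> by auto
      show "uminus ` insert 0 (B \<union> uminus ` B) = insert 0 (B \<union> uminus ` B)"
        using symB by simp
      have "0 \<notin> B \<union> uminus ` B" using sub by auto
      then show "card (insert 0 (B \<union> uminus ` B)) = m"
        using True B(3) cB by (subst card_insert_disjoint) auto
    qed
  next
    case False
    with sub symB cB show ?thesis by (intro that[of "B \<union> uminus ` B"]) auto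
  qed
qed

text \<open>The sets are cut out of \<open>M\<close> one after another. At most one requested size
  is odd, and only that set uses \<open>0\<close>; the others consist of pairs
  \<open>\<plusminus> s\<close>.\<close>

lemma symmetric_partition:
  fixes M :: "real set" and m :: "'a \<Rightarrow> nat"
  assumes "finite N" "finite M" "uminus ` M = M" "(\<Sum>u\<in>N. m u) = card M"
    and "card {u \<in> N. odd (m u)} \<le> 1"
  shows "\<exists>B. (\<forall>u\<in>N. uminus ` B u = B u \<and> card (B u) = m u) \<and> disjoint_family_on B N \<and> (\<Union>u\<in>N. B u) = M"
  using assms
proof (induction N arbitrary: M rule: finite_induct)
  case empty
  then show ?case by (simp add: disjoint_family_on_def)
next
  case (insert u N)
  have eq: "{v \<in> insert u N. odd (m v)} = (if odd (m u) then insert u {v \<in> N. odd (m v)} else {v \<in> N. odd (m v)})"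
    by auto
  have le: "card {v \<in> N. odd (m v)} \<le> 1"
    by (rule order_trans[OF card_mono insert.prems(4)]) (use insert.hyps in auto)
  have none: "odd (m u) \<Longrightarrow> {v \<in> N. odd (m v)} = {}"
    using insert.prems(4) insert.hyps unfolding eq by (auto split: if_splits)
  have sum: "m u + (\<Sum>v\<in>N. m v) = card M" using insert by simp
  \<comment> \<open>If \<open>m u\<close> is odd, all remaining sizes are even, so
    \<open>card M\<close> is odd and \<open>M\<close> contains \<open>0\<close>.\<close>
  have "odd (card M)" if "odd (m u)"
  proof -
    have "even (\<Sum>v\<in>N. m v)" using none[OF that] by (intro dvd_sum) auto
    with that sum show ?thesis by (metis even_add)
  qed
  then obtain A where A: "A \<subseteq> M" "uminus ` A = A" "card A = m u"
    using obtain_symmetric_subset[of M "m u"] insert.prems sum by (metis le_add1)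
  have "uminus ` (M - A) = M - A"
    using insert.prems(2) A(2) by (subst image_set_diff) auto
  moreover have "(\<Sum>v\<in>N. m v) = card (M - A)"
    using sum A insert.prems(1) finite_subset[OF A(1)] by (simp add: card_Diff_subset)
  ultimately obtain B where B: "\<forall>v\<in>N. uminus ` B v = B v \<and> card (B v) = m v"
    "disjoint_family_on B N" "(\<Union>v\<in>N. B v) = M - A"
    using insert.IH[of "M - A"] insert.prems(1) le by auto
  have upd: "(B(u := A)) v = B v" if "v \<in> N" for v using that insert.hyps by auto
  show ?case
  proof (intro exI[of _ "B(u := A)"] conjI)
    show "\<forall>v\<in>insert u N. uminus ` (B(u := A)) v = (B(u := A)) v \<and> card ((B(u := A)) v) = m v"
      using A B by auto
    have "disjoint_family_on (B(u := A)) N"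
      using B(2) upd by (simp add: disjoint_family_on_def)
    then show "disjoint_family_on (B(u := A)) (insert u N)"
      using B(3) upd insert.hyps by (subst disjoint_family_on_insert) auto
    show "(\<Union>v\<in>insert u N. (B(u := A)) v) = M" using B(3) A(1) insert.hyps by (simp add: fun_upd_def) auto
  qed
qed

section \<open>Gluing matrices at a vertex\<close>

text \<open>\<open>(p, q)\<close> plays the role of the characteristic polynomials of the matrix and of its principal
  submatrix without \<open>w\<close>. Up to normalization, \<open>f\<close> is a column of the adjugate; at the roots of \<open>p\<close>
  and of \<open>q\<close> it yields the eigenvectors.\<close>

definition realizes ::
  "'a set \<Rightarrow> ('a \<times> 'a) set \<Rightarrow> 'a \<Rightarrow> real poly \<Rightarrow> real poly \<Rightarrow> ('a \<Rightarrow> 'a \<Rightarrow> real) \<Rightarrow> bool" where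
  "realizes V E w p q a \<longleftrightarrow>
     (\<forall>i\<in>V. \<forall>j\<in>V. a i j = - a j i) \<and>
     (\<forall>i\<in>V. \<forall>j\<in>V. a i j \<noteq> 0 \<longleftrightarrow> (i, j) \<in> E) \<and>
     (\<forall>x. \<exists>f. f w = complex_of_real (poly q x) \<and>
       (\<forall>i\<in>V. (\<Sum>j\<in>V. of_real (a i j) * f j) =
          \<i> * of_real x * f i - (if i = w then \<i> * of_real (poly p x) else 0)))"

text \<open>The branch matrices are joined to \<open>w\<close> by entries \<open>b u\<close> and
  \<open>- b u\<close> at their roots. The formula for \<open>P\<close> corresponds to expanding the
  characteristic polynomial along \<open>w\<close>; the proof glues the vectors of the branches
  instead.\<close>

lemma realizes_glue:
  fixes C :: "'a \<Rightarrow> 'a set" and b :: "'a \<Rightarrow> real"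
  assumes "finite N" and finC: "\<And>u. u \<in> N \<Longrightarrow> finite (C u)"
    and root: "\<And>u. u \<in> N \<Longrightarrow> u \<in> C u"
    and w: "\<And>u. u \<in> N \<Longrightarrow> w \<notin> C u"
    and disj: "disjoint_family_on C N"
    and V: "V = insert w (\<Union>u\<in>N. C u)"
    and Eww: "(w, w) \<notin> E"
    and Ew: "\<And>i. i \<in> V \<Longrightarrow> (w, i) \<in> E \<longleftrightarrow> i \<in> N" "\<And>i. i \<in> V \<Longrightarrow> (i, w) \<in> E \<longleftrightarrow> i \<in> N"
    and Esep: "\<And>u v i j. u \<in> N \<Longrightarrow> v \<in> N \<Longrightarrow> u \<noteq> v \<Longrightarrow> i \<in> C u \<Longrightarrow> j \<in> C v \<Longrightarrow> (i, j) \<notin> E"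
    and Ein: "\<And>u i j. u \<in> N \<Longrightarrow> i \<in> C u \<Longrightarrow> j \<in> C u \<Longrightarrow> (i, j) \<in> E \<longleftrightarrow> (i, j) \<in> F u"
    and b: "\<And>u. u \<in> N \<Longrightarrow> b u > 0"
    and real: "\<And>u. u \<in> N \<Longrightarrow> realizes (C u) (F u) u (p u) (q u) (a u)"
    and P: "P = [:0, 1:] * Q - (\<Sum>u\<in>N. Polynomial.smult ((b u)\<^sup>2) (q u * (\<Prod>v\<in>N - {u}. p v)))"
    and Q: "Q = (\<Prod>u\<in>N. p u)"
  shows "\<exists>a. realizes V E w P Q a"
proof -
  \<comment> \<open>The branch containing \<open>i\<close>; disjointness makes the choice unique on
    the union of the \<open>C u\<close>.\<close>
  define br where "br i = (SOME u. u \<in> N \<and> i \<in> C u)" for i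
  have br: "br i = u" if "u \<in> N" "i \<in> C u" for u i
  proof -
    have "br i \<in> N \<and> i \<in> C (br i)" unfolding br_def by (rule someI[of _ u]) (use that in auto)
    then show ?thesis using that disj by (auto simp: disjoint_family_on_def)
  qed
  have NV: "N \<subseteq> V" and wN: "w \<notin> N" using root w V by auto
  define A where "A i j =
    (if i = w then (if j \<in> N then b j else 0)
     else if j = w then (if i \<in> N then - b i else 0)
     else if br i = br j then a (br i) i j else 0)" for i j
  have rl: "a u i j = - a u j i" "a u i j \<noteq> 0 \<longleftrightarrow> (i, j) \<in> F u" if "u \<in> N" "i \<in> C u" "j \<in> C u" for u i j
    using real[OF that(1)] that unfolding realizes_def by blast+
  have Vcases: "i = w \<or> (\<exists>u\<in>N. i \<in> C u \<and> br i = u \<and> i \<noteq> w)" if "i \<in> V" for i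
    using that w br unfolding V by blast
  have rootN: "i = u" if "u \<in> N" "i \<in> C u" "i \<in> N" for i u
    using br[OF that(1,2)] br[OF that(3) root[OF that(3)]] by simp
  have "A i j = - A j i" if "i \<in> V" "j \<in> V" for i j
    using Vcases[OF that(1)] Vcases[OF that(2)] wN
    by (auto simp: A_def intro: rl(1))
  moreover have "A i j \<noteq> 0 \<longleftrightarrow> (i, j) \<in> E" if ij: "i \<in> V" "j \<in> V" for i j
  proof (cases "i = w \<or> j = w")
    case True
    then show ?thesis using Ew ij Eww wN b unfolding A_def by (auto simp: less_le)
  next
    case False
    then obtain u v where "u \<in> N" "i \<in> C u" "br i = u" "v \<in> N" "j \<in> C v" "br j = v"
      using Vcases ij by metis
    then show ?thesis using False Esep Ein rl(2) by (cases "u = v") (auto simp: A_def)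
  qed
  moreover have "\<exists>f. f w = complex_of_real (poly Q x) \<and>
       (\<forall>i\<in>V. (\<Sum>j\<in>V. of_real (A i j) * f j) =
          \<i> * of_real x * f i - (if i = w then \<i> * of_real (poly P x) else 0))" for x
  proof -
    have "\<forall>u\<in>N. \<exists>f. f u = complex_of_real (poly (q u) x) \<and>
       (\<forall>i\<in>C u. (\<Sum>j\<in>C u. of_real (a u i j) * f j) =
          \<i> * of_real x * f i - (if i = u then \<i> * of_real (poly (p u) x) else 0))"
      using real unfolding realizes_def by blast
    then obtain g where g: "\<And>u. u \<in> N \<Longrightarrow> g u u = complex_of_real (poly (q u) x)"
       "\<And>u i. u \<in> N \<Longrightarrow> i \<in> C u \<Longrightarrow> (\<Sum>j\<in>C u. of_real (a u i j) * g u j) =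
          \<i> * of_real x * g u i - (if i = u then \<i> * of_real (poly (p u) x) else 0)"
      by metis
    \<comment> \<open>\<open>R u\<close> stands for \<open>Q / p u\<close> at \<open>x\<close>; as a
      product it also makes sense where \<open>p u\<close> vanishes.\<close>
    define R where "R u = complex_of_real (poly (\<Prod>v\<in>N - {u}. p v) x)" for u
    \<comment> \<open>The scale \<open>\<i> * b u * R u\<close> is dictated by row \<open>u\<close>:
      the defect \<open>\<i> * p u\<close> of \<open>g u\<close> has to cancel the contribution
      \<open>- b u * f w\<close>, where \<open>f w\<close> is \<open>Q = p u * R u\<close> at
      \<open>x\<close>.\<close>
    define f where "f i = (if i = w then of_real (poly Q x)
       else \<i> * of_real (b (br i)) * R (br i) * g (br i) i)" for i
    have fC: "f i = \<i> * of_real (b u) * R u * g u i" if "u \<in> N" "i \<in> C u" for u i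
      using that w[of u] br[OF that] by (auto simp: f_def)
    have QR: "of_real (poly Q x) = of_real (poly (p u) x) * R u" if "u \<in> N" for u
      unfolding Q R_def by (subst prod.remove[OF assms(1) that]) simp
    have sumV: "(\<Sum>j\<in>V. h j) = h w + (\<Sum>u\<in>N. \<Sum>j\<in>C u. h j)" for h :: "'a \<Rightarrow> complex"
    proof -
      have "(\<Sum>j\<in>V. h j) = h w + (\<Sum>j\<in>(\<Union>u\<in>N. C u). h j)"
        unfolding V using assms(1) finC w by (subst sum.insert) auto
      also have "(\<Sum>j\<in>(\<Union>u\<in>N. C u). h j) = (\<Sum>u\<in>N. \<Sum>j\<in>C u. h j)"
        using assms(1) finC disj by (intro sum.UNION_disjoint) (auto simp: disjoint_family_on_def)
      finally show ?thesis .
    qed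
    \<comment> \<open>In row \<open>w\<close> each branch contributes \<open>\<i>\<close> times its
      term of the sum in \<open>P\<close>, so the row sum is \<open>\<i> * (x * Q - P)\<close> at
      \<open>x\<close>.\<close>
    have "(\<Sum>j\<in>V. of_real (A w j) * f j) =
       \<i> * of_real x * f w - \<i> * of_real (poly P x)"
    proof -
      have "(\<Sum>j\<in>C u. of_real (A w j) * f j) = \<i> * of_real ((b u)\<^sup>2 * poly (q u) x) * R u"
        if u: "u \<in> N" for u
      proof -
        have "(\<Sum>j\<in>C u. of_real (A w j) * f j) = (\<Sum>j\<in>C u. if j = u then of_real (b u) * f u else 0)"
          by (rule sum.cong) (use rootN u in \<open>auto simp: A_def\<close>)
        also have "\<dots> = of_real (b u) * f u" using finC root u by simp
        finally show ?thesis using u root by (simp add: fC g(1) power2_eq_square)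
      qed
      then have "(\<Sum>j\<in>V. of_real (A w j) * f j) = (\<Sum>u\<in>N. \<i> * of_real ((b u)\<^sup>2 * poly (q u) x) * R u)"
        using wN unfolding sumV by (simp add: A_def)
      then show ?thesis
        by (simp add: P f_def poly_sum R_def sum_distrib_left algebra_simps)
    qed
    moreover have "(\<Sum>j\<in>V. of_real (A i j) * f j) = \<i> * of_real x * f i"
      if u: "u \<in> N" and i: "i \<in> C u" for u i
    proof -
      have iw: "i \<noteq> w" using w u i by auto
      have "(\<Sum>j\<in>C v. of_real (A i j) * f j) =
          (if v = u then \<i> * of_real (b u) * R u * (\<Sum>j\<in>C u. of_real (a u i j) * g u j) else 0)"
        if v: "v \<in> N" for v
      proof (cases "v = u")
        case True
        have "(\<Sum>j\<in>C u. of_real (A i j) * f j) =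
            (\<Sum>j\<in>C u. \<i> * of_real (b u) * R u * (of_real (a u i j) * g u j))"
          by (rule sum.cong) (use u i iw w br in \<open>auto simp: A_def fC\<close>)
        with True show ?thesis by (simp add: sum_distrib_left)
      next
        case False
        then show ?thesis using u i v iw w br by (auto simp: A_def intro!: sum.neutral)
      qed
      then have "(\<Sum>j\<in>V. of_real (A i j) * f j) = of_real (A i w) * f w
          + \<i> * of_real (b u) * R u * (\<Sum>j\<in>C u. of_real (a u i j) * g u j)"
        unfolding sumV using assms(1) u by simp
      also have "of_real (A i w) * f w = (if i = u then - of_real (b u) * (of_real (poly (p u) x) * R u) else 0)"
      proof (cases "i = u")
        case True
        then have "A i w = - b u" "f w = of_real (poly (p u) x) * R u"
          using iw u QR[OF u] by (simp_all add: A_def f_def)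
        with True show ?thesis by simp
      next
        case False
        then have "i \<notin> N" using rootN[OF u i] by blast
        then have "A i w = 0" using iw by (simp add: A_def)
        with False show ?thesis by simp
      qed
      finally show ?thesis
        unfolding g(2)[OF u i] fC[OF u i] by (cases "i = u") (simp_all add: algebra_simps)
    qed
    ultimately have "(\<Sum>j\<in>V. of_real (A i j) * f j) =
        \<i> * of_real x * f i - (if i = w then \<i> * of_real (poly P x) else 0)" if "i \<in> V" for i
      using Vcases[OF that] by (elim disjE bexE) simp_all
    then show ?thesis
      by (intro exI[of _ f]) (simp add: f_def)
  qed
  ultimately show ?thesis unfolding realizes_def by blast
qed

section \<open>Branches of a tree at a vertex\<close>

lemma arcs_ends_del_vert:
  "arcs_ends (pre_digraph.del_vert T w) = {(i, j) \<in> arcs_ends T. i \<noteq> w \<and> j \<noteq> w}"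
  by (auto simp: arcs_ends_conv pre_digraph.del_vert_simps)

lemma arcs_ends_induce_subgraph: "arcs_ends (T \<restriction> S) = arcs_ends T \<inter> S \<times> S"
  by (auto simp: arcs_ends_conv)

locale tree_vertex =
  fixes T :: "('a, 'b) pre_digraph" and w :: 'a
  assumes tree: "undirected_tree T" and w: "w \<in> verts T"
begin

sublocale graph T
  using tree by (simp add: undirected_tree_def)

definition "D = pre_digraph.del_vert T w"
definition "nbrs = {u. w \<rightarrow>\<^bsub>T\<^esub> u}"
definition "branch u = pre_digraph.scc_of D u"

lemma ends_D: "i \<rightarrow>\<^bsub>D\<^esub> j \<longleftrightarrow> i \<rightarrow>\<^bsub>T\<^esub> j \<and> i \<noteq> w \<and> j \<noteq> w"
  by (auto simp: D_def arcs_ends_del_vert)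

lemma verts_D: "verts D = verts T - {w}"
  by (simp add: D_def pre_digraph.verts_del_vert)

sublocale D: sym_digraph D
proof -
  have "wf_digraph D" unfolding D_def by (rule wf_digraph_del_vert)
  moreover have "symmetric D"
    using arcs_ends_symmetric[OF sym_arcs] by (auto simp: symmetric_def sym_def ends_D)
  ultimately show "sym_digraph D" by (simp add: sym_digraph_def sym_digraph_axioms_def)
qed

lemma dominates_sym: "i \<rightarrow>\<^bsub>T\<^esub> j \<Longrightarrow> j \<rightarrow>\<^bsub>T\<^esub> i"
  by (rule arcs_ends_symmetric[OF sym_arcs])

lemma nbrs_subset: "nbrs \<subseteq> verts D"
  using adj_in_verts adj_not_same by (auto simp: nbrs_def verts_D)

lemma branch_subset: "u \<in> verts D \<Longrightarrow> branch u \<subseteq> verts D"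
  unfolding branch_def using D.scc_of_in_sccs_verts D.sccs_verts_subsets by blast

lemma self_in_branch: "u \<in> verts D \<Longrightarrow> u \<in> branch u"
  unfolding branch_def by (rule D.in_scc_of_self)

text \<open>If two branches met, a path between their roots would avoid \<open>w\<close>; closed up
  by the two edges at \<open>w\<close>, it would become a cycle.\<close>

lemma disjoint_branches: "disjoint_family_on branch nbrs"
  unfolding disjoint_family_on_def
proof (intro ballI impI, rule ccontr)
  fix u v assume u: "u \<in> nbrs" and v: "v \<in> nbrs" and "u \<noteq> v" and "branch u \<inter> branch v \<noteq> {}"
  then obtain x where "x \<in> branch u" "x \<in> branch v" by auto
  then have "u \<rightarrow>\<^sup>*\<^bsub>D\<^esub> v"
    unfolding branch_def D.scc_of_def using D.reachable_trans by blast
  then obtain p where "D.apath u p v" unfolding D.reachable_apath by blast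
  then have Dp: "D.awalk u p v" and "distinct (D.awalk_verts u p)" by (auto simp: D.apath_def)
  have "subgraph D T" unfolding D_def by (rule subgraph_del_vert)
  then have "compatible D T" by (simp add: subgraph_def compatible_def)
  \<comment> \<open>\<open>D\<close> keeps the end maps of \<open>T\<close>, so the path has the
    same vertex sequence in both graphs.\<close>
  then have verts_eq: "D.awalk_verts u p = awalk_verts u p"
    by (simp add: compatible_awalk_verts)
  have p: "awalk u p v" using subgraph_awalk_imp_awalk[OF Dp \<open>subgraph D T\<close>] .
  have dist: "distinct (awalk_verts u p)" using \<open>distinct (D.awalk_verts u p)\<close> by (simp add: verts_eq)
  have "set (awalk_verts u p) \<subseteq> verts D" using Dp D.awalk_conv verts_eq by metis
  then have notin: "w \<notin> set (awalk_verts u p)" by (auto simp: verts_D)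
  obtain e where e: "e \<in> arcs T" "tail T e = w" "head T e = u" using u by (auto simp: nbrs_def)
  have "v \<rightarrow>\<^bsub>T\<^esub> w" using v dominates_sym by (simp add: nbrs_def)
  then obtain e' where e': "e' \<in> arcs T" "tail T e' = v" "head T e' = w" by auto
  have "awalk v [e'] w" using e' by (auto simp: awalk_simps)
  then have walk: "awalk u (p @ [e']) w" by (rule awalk_appendI[OF p])
  then have "awalk w (e # p @ [e']) w" using e unfolding awalk_Cons_iff by simp
  moreover have "distinct (awalk_verts u (p @ [e']))"
    unfolding awalk_verts_append[OF walk] using dist notin p e' by simp
  ultimately have "cycle (e # p @ [e'])"
    unfolding cycle_def using e by (intro exI[of _ w]) simp
  \<comment> \<open>Distinct roots make \<open>p\<close> nonempty, so the cycle is not merely an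
    edge walked back and forth.\<close>
  moreover have "p \<noteq> []" using p \<open>u \<noteq> v\<close> by (auto simp: awalk_Nil_iff)
  then have "3 \<le> length (e # p @ [e'])" by (cases p) auto
  ultimately show False using tree unfolding undirected_tree_def by blast
qed

text \<open>A path from \<open>w\<close> to \<open>x\<close> leaves \<open>w\<close> by its first
  arc and never returns, so its rest lies in the branch of the neighbor reached first.\<close>

lemma Union_branches: "(\<Union>u\<in>nbrs. branch u) = verts T - {w}"
proof (intro equalityI subsetI)
  fix x assume x: "x \<in> verts T - {w}"
  have "strongly_connected T"
    using tree symmetric_connected_imp_strongly_connected[OF sym_arcs] by (simp add: undirected_tree_def)
  then have "w \<rightarrow>\<^sup>*\<^bsub>T\<^esub> x" using x w by (auto simp: strongly_connected_def)
  then obtain q where q: "apath w q x" unfolding reachable_apath by blast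
  with x obtain e es where "q = e # es" by (cases q) (auto simp: apath_simps)
  with q have e: "e \<in> arcs T" "tail T e = w" and es: "apath (head T e) es x"
    "w \<notin> set (awalk_verts (head T e) es)" by (auto simp: apath_Cons_iff)
  \<comment> \<open>The start vertex is generalized so that the walk can be transferred to
    \<open>D\<close> arc by arc.\<close>
  have "y \<in> verts D \<Longrightarrow> awalk y es x \<Longrightarrow> w \<notin> set (awalk_verts y es) \<Longrightarrow> y \<rightarrow>\<^sup>*\<^bsub>D\<^esub> x" for y
  proof (induction es arbitrary: y)
    case Nil
    then show ?case by (auto simp: awalk_Nil_iff)
  next
    case (Cons a es)
    then have a: "a \<in> arcs T" "y = tail T a" "awalk (head T a) es x"
      "w \<noteq> tail T a" "w \<notin> set (awalk_verts (head T a) es)"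
      by (auto simp: awalk_Cons_iff)
    have "head T a \<noteq> w" using hd_in_awalk_verts(1)[OF a(3)] a(5) by auto
    then have "y \<rightarrow>\<^bsub>D\<^esub> head T a"
      using a in_arcs_imp_in_arcs_ends[OF a(1)] by (auto simp: ends_D)
    moreover have "head T a \<rightarrow>\<^sup>*\<^bsub>D\<^esub> x"
      using Cons.IH a \<open>head T a \<noteq> w\<close> by (auto simp: verts_D)
    ultimately show ?case by (rule D.adj_reachable_trans)
  qed
  moreover have u: "head T e \<in> nbrs"
    using in_arcs_imp_in_arcs_ends[OF e(1)] e(2) by (simp add: nbrs_def)
  ultimately have "head T e \<rightarrow>\<^sup>*\<^bsub>D\<^esub> x"
    using es nbrs_subset by (auto simp: apath_def)
  then have "x \<in> branch (head T e)" unfolding branch_def by (rule D.scc_ofI_reachable')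
  then show "x \<in> (\<Union>u\<in>nbrs. branch u)" using u by blast
qed (use branch_subset nbrs_subset verts_D in blast)

lemma sccs_verts_D: "pre_digraph.sccs_verts D = branch ` nbrs"
proof (intro equalityI subsetI)
  fix S assume "S \<in> D.sccs_verts"
  then obtain x where x: "x \<in> verts D" "S = branch x"
    unfolding D.sccs_verts_conv_scc_of branch_def by auto
  then obtain u where "u \<in> nbrs" "x \<in> branch u" using Union_branches verts_D by blast
  then show "S \<in> branch ` nbrs" using x D.scc_of_eq unfolding branch_def by blast
qed (use nbrs_subset D.scc_of_in_sccs_verts in \<open>auto simp: branch_def\<close>)

lemma inj_on_branch: "inj_on branch nbrs"
  using disjoint_branches self_in_branch nbrs_subset unfolding disjoint_family_on_def
  by (intro inj_onI) blast

text \<open>An arc avoiding \<open>w\<close> survives in \<open>D\<close> and puts both of its ends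
  in the same component.\<close>

lemma no_arc_between_branches:
  assumes "u \<in> nbrs" "v \<in> nbrs" "u \<noteq> v" "i \<in> branch u" "j \<in> branch v"
  shows "\<not> i \<rightarrow>\<^bsub>T\<^esub> j"
proof
  assume "i \<rightarrow>\<^bsub>T\<^esub> j"
  moreover have "i \<noteq> w" "j \<noteq> w" using assms branch_subset nbrs_subset verts_D by blast+
  ultimately have "i \<rightarrow>\<^bsub>D\<^esub> j" by (simp add: ends_D)
  then have "i \<in> D.scc_of j" by (intro D.scc_ofI_reachable) auto
  then have "i \<in> branch v" using assms(5) D.scc_of_eq unfolding branch_def by blast
  then show False using assms disjoint_branches by (auto simp: disjoint_family_on_def)
qed

lemma branch_at_eq: "branch_at T w u = D \<restriction> branch u"
  by (simp add: branch_at_def D_def branch_def)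

lemma verts_branch: "verts (branch_at T w u) = branch u"
  by (simp add: branch_at_eq)

lemma dominates_branch:
  assumes "u \<in> nbrs" "i \<in> branch u" "j \<in> branch u"
  shows "i \<rightarrow>\<^bsub>branch_at T w u\<^esub> j \<longleftrightarrow> i \<rightarrow>\<^bsub>T\<^esub> j"
proof -
  have "i \<noteq> w" "j \<noteq> w" using assms branch_subset nbrs_subset verts_D by blast+
  then show ?thesis using assms by (simp add: branch_at_eq arcs_ends_induce_subgraph ends_D)
qed

lemma odd_components_D: "odd_components D = branch ` {u \<in> nbrs. odd (card (branch u))}"
  by (auto simp: odd_components_def sccs_verts_D)

text \<open>Turns the count of odd components in the NEB condition into the count of odd sizes
  required by \<open>symmetric_partition\<close>.\<close>

lemma card_odd_components_D: "card (odd_components D) = card {u \<in> nbrs. odd (card (branch u))}"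
  unfolding odd_components_D by (rule card_image) (rule inj_on_subset[OF inj_on_branch], auto)

end

section \<open>Matrices for nearly even branching trees\<close>

lemma node_poly_UNION:
  assumes "finite N" "\<And>u. u \<in> N \<Longrightarrow> finite (B u)" "disjoint_family_on B N"
  shows "node_poly (\<Union>u\<in>N. B u) = (\<Prod>u\<in>N. node_poly (B u))"
  unfolding node_poly_def using assms
  by (intro prod.UNION_disjoint) (auto simp: disjoint_family_on_def)

text \<open>Partial fractions are summed group by group, and each partial sum is expanded to the
  common denominator.\<close>

lemma weighted_poly_UNION:
  assumes "finite N" and fin: "\<And>u. u \<in> N \<Longrightarrow> finite (B u)" and "disjoint_family_on B N"
  shows "weighted_poly (\<Union>u\<in>N. B u) c =
    (\<Sum>u\<in>N. weighted_poly (B u) c * (\<Prod>v\<in>N - {u}. node_poly (B v)))"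
proof -
  have "weighted_poly (\<Union>u\<in>N. B u) c =
      (\<Sum>u\<in>N. \<Sum>s\<in>B u. Polynomial.smult (c s) (node_poly ((\<Union>v\<in>N. B v) - {s})))"
    unfolding weighted_poly_def using assms
    by (intro sum.UNION_disjoint) (auto simp: disjoint_family_on_def)
  also have "\<dots> = (\<Sum>u\<in>N. weighted_poly (B u) c * (\<Prod>v\<in>N - {u}. node_poly (B v)))"
  proof (rule sum.cong[OF refl])
    fix u assume u: "u \<in> N"
    have "node_poly ((\<Union>v\<in>N. B v) - {s}) = node_poly (B u - {s}) * (\<Prod>v\<in>N - {u}. node_poly (B v))"
      if s: "s \<in> B u" for s
    proof -
      have dj: "(B u - {s}) \<inter> (\<Union>v\<in>N - {u}. B v) = {}"
        using assms(3) u by (auto simp: disjoint_family_on_def)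
      have "(\<Union>v\<in>N. B v) - {s} = (B u - {s}) \<union> (\<Union>v\<in>N - {u}. B v)"
        using assms(3) u s by (auto simp: disjoint_family_on_def)
      then have "node_poly ((\<Union>v\<in>N. B v) - {s}) = node_poly (B u - {s}) * node_poly (\<Union>v\<in>N - {u}. B v)"
        using dj fin u assms(1) by (simp add: node_poly_def prod.union_disjoint)
      also have "node_poly (\<Union>v\<in>N - {u}. B v) = (\<Prod>v\<in>N - {u}. node_poly (B v))"
        using assms by (intro node_poly_UNION) (auto simp: disjoint_family_on_def)
      finally show ?thesis .
    qed
    then show "(\<Sum>s\<in>B u. Polynomial.smult (c s) (node_poly ((\<Union>v\<in>N. B v) - {s})))
        = weighted_poly (B u) c * (\<Prod>v\<in>N - {u}. node_poly (B v))"
      by (simp add: weighted_poly_def sum_distrib_right)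
  qed
  finally show ?thesis .
qed

lemma smult_weighted_poly:
  "Polynomial.smult k (weighted_poly S c) = weighted_poly S (\<lambda>s. k * c s)"
  by (simp add: weighted_poly_def smult_sum2)

text \<open>Nodes and weights replace the interlacing pair, since
  \<open>node_poly_division_step\<close> yields such data for each branch once the weights are
  normalized. Total weight 1 makes \<open>weighted_poly L c\<close> monic.\<close>

lemma NEB_realizable:
  assumes "NEB T w" and "finite L" "card L = card (verts T)" "uminus ` L = L"
    and "\<And>l. l \<in> L \<Longrightarrow> c l > 0" "\<And>l. l \<in> L \<Longrightarrow> c (- l) = c l" "(\<Sum>l\<in>L. c l) = 1"
  shows "\<exists>a. realizes (verts T) (arcs_ends T) w (node_poly L) (weighted_poly L c) a"
  using assms
proof (induction T w arbitrary: L c rule: NEB.induct)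
  case (NEB_single T w)
  then have "card L = 1" by simp
  then obtain l where "L = {l}" using card_1_singletonE by blast
  \<comment> \<open>A symmetric set with a single element is \<open>{0}\<close>; the zero matrix of
    order 1 then works, with polynomials \<open>x\<close> and \<open>1\<close>.\<close>
  then have L: "L = {0}" using NEB_single.prems(3) by auto
  interpret graph T using NEB_single(1) by (simp add: undirected_tree_def)
  have "(w, w) \<notin> arcs_ends T" using adj_not_same by blast
  moreover have "c 0 = 1" using NEB_single.prems(6) L by simp
  ultimately show ?case
    unfolding realizes_def NEB_single(2) L
    by (intro exI[of _ "\<lambda>_ _. 0"]) (auto simp: poly_weighted_poly poly_node_poly intro!: exI[of _ "\<lambda>_. 1"])
next
  case (NEB_branch T w)
  interpret tree_vertex T w using NEB_branch(1,2) by unfold_locales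
  have cardL: "card L \<ge> 2" using NEB_branch by simp
  then have "L \<noteq> {}" by auto
  then obtain M d where M: "finite M" "card M = card L - 1" "uminus ` M = M"
    "\<And>m. m \<in> M \<Longrightarrow> d m > 0" "\<And>m. m \<in> M \<Longrightarrow> d (- m) = d m"
    "weighted_poly L c = node_poly M"
    "node_poly L = [:0, 1:] * node_poly M - weighted_poly M d"
    using node_poly_division_step[of L c] NEB_branch.prems by metis
  have "finite (verts D)" by (simp add: verts_D)
  then have finN: "finite nbrs" and finC: "\<And>u. u \<in> nbrs \<Longrightarrow> finite (branch u)"
    using nbrs_subset branch_subset by (blast intro: finite_subset)+
  have root: "\<And>u. u \<in> nbrs \<Longrightarrow> u \<in> branch u" using self_in_branch nbrs_subset by blast
  have "(\<Sum>u\<in>nbrs. card (branch u)) = card (\<Union>u\<in>nbrs. branch u)"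
    using finN finC disjoint_branches
    by (intro card_UN_disjoint[symmetric]) (auto simp: disjoint_family_on_def)
  also have "\<dots> = card M" using M(2) NEB_branch.prems(2) w by (simp add: Union_branches)
  finally have sum: "(\<Sum>u\<in>nbrs. card (branch u)) = card M" .
  \<comment> \<open>Either parity of the order allows at most one odd branch, which is what the
    symmetric splitting of \<open>M\<close> needs.\<close>
  have "card (odd_components D) \<le> 1"
    using NEB_branch(4,5) by (cases "even (card (verts T))") (auto simp: D_def)
  then have odd: "card {u \<in> nbrs. odd (card (branch u))} \<le> 1" by (simp add: card_odd_components_D)
  obtain B where B: "\<And>u. u \<in> nbrs \<Longrightarrow> uminus ` B u = B u"
    "\<And>u. u \<in> nbrs \<Longrightarrow> card (B u) = card (branch u)"
    "disjoint_family_on B nbrs" "(\<Union>u\<in>nbrs. B u) = M"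
    using symmetric_partition[OF finN M(1,3) sum odd] by blast
  have BM: "B u \<subseteq> M" if "u \<in> nbrs" for u using B(4) that by blast
  have finB: "finite (B u)" if "u \<in> nbrs" for u using BM[OF that] M(1) finite_subset by blast
  have neB: "B u \<noteq> {}" if "u \<in> nbrs" for u
    using B(2)[OF that] finC[OF that] root[OF that] by force
  \<comment> \<open>The total weight of the group of \<open>u\<close>: dividing by it restores total
    weight 1, and its square root becomes the entry between \<open>w\<close> and
    \<open>u\<close>.\<close>
  define s where "s u = (\<Sum>m\<in>B u. d m)" for u
  have s: "s u > 0" if "u \<in> nbrs" for u
    unfolding s_def using finB neB BM M(4) that by (intro sum_pos) blast+
  define q where "q u = weighted_poly (B u) (\<lambda>m. d m / s u)" for u
  have "\<exists>a. realizes (branch u) (arcs_ends (branch_at T w u)) u (node_poly (B u)) (q u) a"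
    if u: "u \<in> nbrs" for u
    unfolding q_def verts_branch[symmetric]
  proof (rule NEB_branch.IH)
    show "w \<rightarrow>\<^bsub>T\<^esub> u" using u by (simp add: nbrs_def)
    show "card (B u) = card (verts (branch_at T w u))" by (simp add: verts_branch B(2) u)
    show "\<And>l. l \<in> B u \<Longrightarrow> d l / s u > 0" "\<And>l. l \<in> B u \<Longrightarrow> d (- l) / s u = d l / s u"
      using M(4,5) BM[OF u] s[OF u] by auto
    show "(\<Sum>l\<in>B u. d l / s u) = 1"
      using s[OF u] by (simp add: sum_divide_distrib[symmetric] s_def)
  qed (use finB B u in auto)
  then obtain a where a: "\<And>u. u \<in> nbrs \<Longrightarrow>
      realizes (branch u) (arcs_ends (branch_at T w u)) u (node_poly (B u)) (q u) (a u)"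
    by metis
  have nodeM: "node_poly M = (\<Prod>u\<in>nbrs. node_poly (B u))"
    unfolding B(4)[symmetric] by (rule node_poly_UNION[OF finN finB B(3)])
  have "weighted_poly M d = (\<Sum>u\<in>nbrs. weighted_poly (B u) d * (\<Prod>v\<in>nbrs - {u}. node_poly (B v)))"
    unfolding B(4)[symmetric] by (rule weighted_poly_UNION[OF finN finB B(3)])
  also have "\<dots> = (\<Sum>u\<in>nbrs. Polynomial.smult ((sqrt (s u))\<^sup>2)
      (q u * (\<Prod>v\<in>nbrs - {u}. node_poly (B v))))"
  proof (rule sum.cong[OF refl])
    fix u assume "u \<in> nbrs"
    then have "weighted_poly (B u) d = Polynomial.smult ((sqrt (s u))\<^sup>2) (q u)"
      using s[of u] by (simp add: q_def smult_weighted_poly)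
    then show "weighted_poly (B u) d * (\<Prod>v\<in>nbrs - {u}. node_poly (B v)) =
        Polynomial.smult ((sqrt (s u))\<^sup>2) (q u * (\<Prod>v\<in>nbrs - {u}. node_poly (B v)))"
      by simp
  qed
  finally have P: "node_poly L = [:0, 1:] * node_poly M - (\<Sum>u\<in>nbrs. Polynomial.smult ((sqrt (s u))\<^sup>2)
      (q u * (\<Prod>v\<in>nbrs - {u}. node_poly (B v))))"
    using M(7) by simp
  have wb: "w \<notin> branch u" if "u \<in> nbrs" for u
    using that branch_subset nbrs_subset verts_D by blast
  have V: "verts T = insert w (\<Union>u\<in>nbrs. branch u)" using w by (auto simp: Union_branches)
  show ?case
    unfolding M(6)
  proof (rule realizes_glue[OF finN finC root wb disjoint_branches V _ _ _ _ _ _ a P nodeM])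
    show "(w, w) \<notin> arcs_ends T" using adj_not_same by blast
    show "(w, i) \<in> arcs_ends T \<longleftrightarrow> i \<in> nbrs" "(i, w) \<in> arcs_ends T \<longleftrightarrow> i \<in> nbrs" for i
      using dominates_sym by (auto simp: nbrs_def)
  qed (use no_arc_between_branches dominates_branch s in auto)
qed

section \<open>Interlacing sequences and spectra\<close>

lemma interlacing_less:
  fixes lam mu :: "nat \<Rightarrow> real"
  assumes "\<And>j. j \<in> {1..n - 1} \<Longrightarrow> lam j < mu j \<and> mu j < lam (j + 1)"
    and "1 \<le> j" "j < k" "k \<le> n"
  shows "lam j < lam k"
  using assms(3,4)
proof (induction k)
  case (Suc k)
  then have "k \<in> {1..n - 1}" using assms(2) by auto
  then have "lam k < lam (Suc k)" using assms(1)[of k] by auto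
  then show ?case using Suc by (cases "j = k") auto
qed simp

text \<open>The factors are matched so that each quotient is positive: for \<open>k < i\<close> both
  \<open>mu k\<close> and \<open>lam k\<close> lie below \<open>lam i\<close>; for
  \<open>k \<ge> i\<close> both \<open>mu k\<close> and \<open>lam (k + 1)\<close> lie above
  it.\<close>

lemma interlacing_quotient_pos:
  fixes lam mu :: "nat \<Rightarrow> real"
  assumes inter: "\<And>j. j \<in> {1..n - 1} \<Longrightarrow> lam j < mu j \<and> mu j < lam (j + 1)"
    and i: "i \<in> {1..n}"
  shows "(\<Prod>k\<in>{1..n - 1}. lam i - mu k) / (\<Prod>j\<in>{1..n} - {i}. lam i - lam j) > 0"
proof -
  define \<sigma> where "\<sigma> k = (if k < i then k else k + 1)" for k
  have less: "lam j < lam k" if "1 \<le> j" "j < k" "k \<le> n" for j k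
    using interlacing_less[of n lam mu, OF inter that] .
  have "bij_betw \<sigma> {1..n - 1} ({1..n} - {i})"
    by (rule bij_betw_byWitness[where f' = "\<lambda>j. if j < i then j else j - 1"])
      (use i in \<open>auto simp: \<sigma>_def\<close>)
  then have "(\<Prod>j\<in>{1..n} - {i}. lam i - lam j) = (\<Prod>k\<in>{1..n - 1}. lam i - lam (\<sigma> k))"
    by (rule prod.reindex_bij_betw[symmetric])
  then have "(\<Prod>k\<in>{1..n - 1}. lam i - mu k) / (\<Prod>j\<in>{1..n} - {i}. lam i - lam j)
      = (\<Prod>k\<in>{1..n - 1}. (lam i - mu k) / (lam i - lam (\<sigma> k)))"
    by (simp add: prod_dividef)
  also have "\<dots> > 0"
  proof (rule prod_pos)
    fix k assume k: "k \<in> {1..n - 1}"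
    show "(lam i - mu k) / (lam i - lam (\<sigma> k)) > 0"
    proof (cases "k < i")
      case True
      then have "lam (k + 1) \<le> lam i" using less[of "k + 1" i] i by (cases "k + 1 = i") auto
      then show ?thesis using True inter[OF k] by (simp add: \<sigma>_def)
    next
      case False
      moreover have "k \<le> n" using k by auto
      ultimately have "lam i \<le> lam k" using less[of i k] i by (cases "k = i") auto
      then show ?thesis using False inter[OF k] by (simp add: \<sigma>_def divide_neg_neg)
    qed
  qed
  finally show ?thesis .
qed

section \<open>Spectra exhausted by explicit eigenvectors\<close>

lemma spectrum_eqI:
  fixes A :: "'a::field mat"
  assumes "A \<in> carrier_mat n n" "S \<subseteq> spectrum A" "card S = n"
  shows "spectrum A = S"
  using card_finite_spectrum[OF assms(1)] assms(2,3) card_seteq by metis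

lemma mem_spectrumI:
  fixes A :: "'a::field mat"
  assumes "A \<in> carrier_mat n n" "i < n" "f i \<noteq> 0"
    and "\<And>i. i < n \<Longrightarrow> (\<Sum>j<n. A $$ (i, j) * f j) = k * f i"
  shows "k \<in> spectrum A"
proof -
  have "vec n f \<noteq> 0\<^sub>v n"
    using assms(2,3) by (metis index_vec index_zero_vec(1))
  moreover have "A *\<^sub>v vec n f = k \<cdot>\<^sub>v vec n f"
    using assms(1,4) by (intro eq_vecI) (auto simp: scalar_prod_def lessThan_atLeast0)
  ultimately have "eigenvector A (vec n f) k"
    using assms(1) by (simp add: eigenvector_def)
  then show ?thesis by (auto simp: spectrum_def eigenvalue_def)
qed

lemma card_imaginary_image:
  "card ((\<lambda>j. \<i> * complex_of_real (f j)) ` S) = card (f ` S)"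
proof -
  have "inj_on (\<lambda>x. \<i> * complex_of_real x) (f ` S)" by (rule inj_onI) simp
  then show ?thesis using card_image[of "\<lambda>x. \<i> * complex_of_real x" "f ` S"] by (simp add: image_image)
qed

theorem theorem3p1:
  fixes T :: "nat pair_pre_digraph" and n v :: nat and lam mu :: "nat \<Rightarrow> real"
  assumes "undirected_tree (with_proj T)"
    and "pverts T = {..<n}"
    and "2 \<le> n"
    and "\<And>j. j \<in> {1..n - 1} \<Longrightarrow> lam j < mu j \<and> mu j < lam (j + 1)"
    and "\<And>j. j \<in> {1..n} \<Longrightarrow> lam j = - lam (n + 1 - j)"
    and "\<And>k. k \<in> {1..n - 1} \<Longrightarrow> mu k = - mu (n - k)"
    and "v \<in> pverts T"
    and "NEB (with_proj T) v"
  shows "\<exists>A \<in> skew_mats_of_graph T.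
           spectrum (map_mat complex_of_real A) = (\<lambda>j. \<i> * complex_of_real (lam j)) ` {1..n} \<and>
           spectrum (map_mat complex_of_real (mat_delete A v v)) =
             (\<lambda>k. \<i> * complex_of_real (mu k)) ` {1..n - 1}"
proof -
  have less: "lam j < lam k" if "1 \<le> j" "j < k" "k \<le> n" for j k
    using interlacing_less[of n lam mu, OF assms(4) that] .
  have injL: "inj_on lam {1..n}"
    by (rule linorder_inj_onI) (use less in \<open>force+\<close>)
  have "mu j < mu k" if "1 \<le> j" "j < k" "k \<le> n - 1" for j k
  proof -
    have "mu j < lam (j + 1)" "lam k < mu k" using assms(4)[of j] assms(4)[of k] that by auto
    moreover have "lam (j + 1) \<le> lam k" using less[of "j + 1" k] that by (cases "j + 1 = k") force+
    ultimately show ?thesis by simp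
  qed
  then have injM: "inj_on mu {1..n - 1}"
    by (intro linorder_inj_onI) force+
  define L where "L = lam ` {1..n}"
  define M where "M = mu ` {1..n - 1}"
  have finL: "finite L" and finM: "finite M" by (simp_all add: L_def M_def)
  have cardL: "card L = n" and cardM: "card M = n - 1"
    using card_image[OF injL] card_image[OF injM] by (simp_all add: L_def M_def)
  have symL: "uminus ` L = L" and symM: "uminus ` M = M"
    unfolding uminus_image_eq_iff
  proof safe
    fix l assume "l \<in> L"
    then obtain j where j: "j \<in> {1..n}" "l = lam j" by (auto simp: L_def)
    then have "- l = lam (n + 1 - j)" using assms(5)[OF j(1)] by simp
    moreover have "n + 1 - j \<in> {1..n}" using j(1) by auto
    ultimately show "- l \<in> L" unfolding L_def by blast
  next
    fix m assume "m \<in> M"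
    then obtain k where k: "k \<in> {1..n - 1}" "m = mu k" by (auto simp: M_def)
    then have "- m = mu (n - k)" using assms(6)[OF k(1)] by simp
    moreover have "n - k \<in> {1..n - 1}" using k(1) by auto
    ultimately show "- m \<in> M" unfolding M_def by blast
  qed
  \<comment> \<open>The residues of \<open>node_poly M / node_poly L\<close>, that is, its partial
    fraction coefficients.\<close>
  define c where "c l = poly (node_poly M) l / poly (node_poly (L - {l})) l" for l
  have q: "node_poly M = weighted_poly L c"
    unfolding c_def using assms(3) cardL cardM
    by (intro lagrange_interpolation[OF finL] coeff_eq_0) auto
  \<comment> \<open>Compares coefficients in degree \<open>n - 1\<close>, where
    \<open>node_poly M\<close> is monic.\<close>
  have sum: "(\<Sum>l\<in>L. c l) = 1"
    using coeff_weighted_poly[OF finL, of c] coeff_node_poly_card[of M]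
    by (simp add: q cardL cardM)
  \<comment> \<open>Numerator and denominator both have degree \<open>n - 1\<close>, so their signs
    under reflection cancel.\<close>
  have sym: "c (- l) = c l" if "l \<in> L" for l
    using poly_node_poly_reflect[of M l] that finL
    by (simp add: c_def symM cardM cardL poly_node_poly_remove_reflect[OF symL])
  have pos: "c l > 0" if l: "l \<in> L" for l
  proof -
    obtain i where i: "i \<in> {1..n}" "l = lam i" using l unfolding L_def by blast
    have "L - {l} = lam ` ({1..n} - {i})"
      unfolding L_def i(2) using injL i(1) by (subst inj_on_image_set_diff[of _ "{1..n}"]) auto
    then have "poly (node_poly (L - {l})) l = (\<Prod>j\<in>{1..n} - {i}. lam i - lam j)"
      using inj_on_subset[OF injL] by (simp add: poly_node_poly i(2) prod.reindex)
    moreover have "poly (node_poly M) l = (\<Prod>k\<in>{1..n - 1}. lam i - mu k)"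
      unfolding M_def i(2) poly_node_poly by (subst prod.reindex[OF injM]) simp
    ultimately show ?thesis
      using interlacing_quotient_pos[of n lam mu, OF assms(4) i(1)] by (simp add: c_def)
  qed
  obtain a where "realizes (verts (with_proj T)) (arcs_ends (with_proj T)) v (node_poly L) (weighted_poly L c) a"
    using NEB_realizable[OF assms(8) finL _ symL pos sym sum] cardL assms(2) by auto
  then have real: "realizes {..<n} (parcs T) v (node_poly L) (node_poly M) a"
    by (simp add: assms(2) q)
  then have skew: "a i j = - a j i" and supp: "a i j \<noteq> 0 \<longleftrightarrow> (i, j) \<in> parcs T"
    if "i < n" "j < n" for i j
    using that unfolding realizes_def by blast+
  define A where "A = mat n n (\<lambda>(i, j). a i j)"
  have vn: "v < n" using assms(2,7) by simp
  have eigen: "\<exists>f. f v = complex_of_real (poly (node_poly M) x) \<and>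
       (\<forall>i<n. (\<Sum>j<n. of_real (a i j) * f j) =
          \<i> * of_real x * f i - (if i = v then \<i> * of_real (poly (node_poly L) x) else 0))" for x
    using real unfolding realizes_def by (metis lessThan_iff)
  \<comment> \<open>Positive residues rule out common roots of the two polynomials; this makes the
    eigenvectors below nonzero.\<close>
  have disj: "poly (node_poly M) l \<noteq> 0" if "l \<in> L" for l
    using pos[OF that] by (auto simp: c_def)
  have "graph_of_mat A = T"
  proof -
    \<comment> \<open>\<open>supp\<close> speaks only of index pairs below \<open>n\<close>;
      well-formedness of \<open>T\<close> ensures that every arc is such a pair.\<close>
    have "wf_digraph (with_proj T)"
      using assms(1) by (simp add: undirected_tree_def graph_def digraph_def fin_digraph_def)
    then have in_n: "i < n \<and> j < n" if "(i, j) \<in> parcs T" for i j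
      using that wf_digraph.tail_in_verts[of "with_proj T" "(i, j)"]
        wf_digraph.head_in_verts[of "with_proj T" "(i, j)"] assms(2) by auto
    have nz: "a i j \<noteq> 0 \<longleftrightarrow> a j i \<noteq> 0" if "i < n" "j < n" for i j using skew[OF that] by simp
    have diag: "a i i = 0" if "i < n" for i using skew[OF that that] by simp
    have "(i, j) \<in> parcs (graph_of_mat A) \<longleftrightarrow> i < n \<and> j < n \<and> i \<noteq> j \<and> a i j \<noteq> 0" for i j
      using nz[of i j] by (cases i j rule: linorder_cases) (auto simp: graph_of_mat_def Let_def A_def)
    moreover have "(i, j) \<in> parcs T \<longleftrightarrow> i < n \<and> j < n \<and> i \<noteq> j \<and> a i j \<noteq> 0" for i j
      using in_n[of i j] supp[of i j] diag[of i] by blast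
    ultimately have "parcs (graph_of_mat A) = parcs T"
      by (intro equalityI subrelI) blast+
    moreover have "pverts (graph_of_mat A) = pverts T"
      by (simp add: graph_of_mat_def Let_def A_def assms(2))
    ultimately show ?thesis by simp
  qed
  moreover have "skew_symmetric_mat A"
    unfolding skew_symmetric_mat_def by (auto simp: A_def intro!: eq_matI skew)
  ultimately have "A \<in> skew_mats_of_graph T" by (simp add: skew_mats_of_graph_def)
  moreover have "spectrum (map_mat complex_of_real A) = (\<lambda>j. \<i> * complex_of_real (lam j)) ` {1..n}"
  proof (rule spectrum_eqI)
    show carr: "map_mat complex_of_real A \<in> carrier_mat n n" by (simp add: A_def)
    show "card ((\<lambda>j. \<i> * complex_of_real (lam j)) ` {1..n}) = n"
      using cardL by (simp only: card_imaginary_image L_def)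
    \<comment> \<open>At a root of \<open>node_poly L\<close> the defect in row \<open>v\<close>
      vanishes, so \<open>f\<close> satisfies the eigenvector equation; it is nonzero because
      \<open>f v\<close> is the value of \<open>node_poly M\<close>.\<close>
    have "\<i> * complex_of_real l \<in> spectrum (map_mat complex_of_real A)" if l: "l \<in> L" for l
    proof -
      obtain f where f: "f v = complex_of_real (poly (node_poly M) l)"
        "\<And>i. i < n \<Longrightarrow> (\<Sum>j<n. of_real (a i j) * f j) = \<i> * of_real l * f i"
        using eigen[of l] l poly_node_poly_eq_0_iff[OF finL] by auto
      show ?thesis
        by (rule mem_spectrumI[OF carr vn, of f]) (use f disj[OF l] in \<open>auto simp: A_def\<close>)
    qed
    then show "(\<lambda>j. \<i> * complex_of_real (lam j)) ` {1..n} \<subseteq> spectrum (map_mat complex_of_real A)"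
      by (auto simp: L_def)
  qed
  moreover have "spectrum (map_mat complex_of_real (mat_delete A v v)) =
      (\<lambda>k. \<i> * complex_of_real (mu k)) ` {1..n - 1}"
  proof (rule spectrum_eqI)
    show carr: "map_mat complex_of_real (mat_delete A v v) \<in> carrier_mat (n - 1) (n - 1)"
      using mat_delete_carrier[of A n n] by (simp add: A_def)
    show "card ((\<lambda>k. \<i> * complex_of_real (mu k)) ` {1..n - 1}) = n - 1"
      using cardM by (simp only: card_imaginary_image M_def)
    \<comment> \<open>\<open>insert_index v\<close> enumerates the indices other than
      \<open>v\<close> in the order used by \<open>mat_delete\<close>.\<close>
    have image: "insert_index v ` {..<n - 1} = {..<n} - {v}"
      using insert_index_image[of v "n - 1"] vn by (simp add: lessThan_atLeast0)
    have entry: "map_mat complex_of_real (mat_delete A v v) $$ (i, j)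
        = of_real (a (insert_index v i) (insert_index v j))" if "i < n - 1" "j < n - 1" for i j
      using that vn by (auto simp: mat_delete_def A_def insert_index_def)
    \<comment> \<open>At a root of \<open>node_poly M\<close> the entry \<open>f v\<close> vanishes,
      so \<open>f\<close> restricted to the other indices solves the equations of the
      submatrix.\<close>
    have "\<i> * complex_of_real m \<in> spectrum (map_mat complex_of_real (mat_delete A v v))"
      if m: "m \<in> M" for m
    proof -
      have "poly (node_poly M) m = 0" using m poly_node_poly_eq_0_iff[OF finM] by simp
      then have pm: "poly (node_poly L) m \<noteq> 0"
        using disj poly_node_poly_eq_0_iff[OF finL] by metis
      obtain f where f: "f v = 0"
        "\<And>i. i < n \<Longrightarrow> (\<Sum>j<n. of_real (a i j) * f j) =
          \<i> * of_real m * f i - (if i = v then \<i> * of_real (poly (node_poly L) m) else 0)"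
        using eigen[of m] \<open>poly (node_poly M) m = 0\<close> by auto
      have sumn: "(\<Sum>j<n. h j * f j) = (\<Sum>j<n - 1. h (insert_index v j) * f (insert_index v j))" for h
      proof -
        have "(\<Sum>j<n. h j * f j) = (\<Sum>j\<in>{..<n} - {v}. h j * f j)"
          using vn f(1) by (subst sum.remove[of "{..<n}" v]) auto
        then show ?thesis
          unfolding image[symmetric] by (simp add: sum.reindex[OF insert_index_inj_on] o_def)
      qed
      \<comment> \<open>If the restriction were zero, row \<open>v\<close> would make
        \<open>m\<close> a root of \<open>node_poly L\<close> as well.\<close>
      have "\<exists>i<n - 1. f (insert_index v i) \<noteq> 0"
      proof (rule ccontr)
        assume "\<not> ?thesis"
        then have "(\<Sum>j<n. of_real (a v j) * f j) = 0" unfolding sumn by simp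
        then show False using f(2)[OF vn] f(1) pm by simp
      qed
      then obtain i where "i < n - 1" "f (insert_index v i) \<noteq> 0" by blast
      then show ?thesis
      proof (rule mem_spectrumI[OF carr])
        fix i assume i: "i < n - 1"
        then have "insert_index v i < n" "insert_index v i \<noteq> v" using image by blast+
        then have "(\<Sum>j<n. of_real (a (insert_index v i) j) * f j) = \<i> * of_real m * f (insert_index v i)"
          by (simp add: f(2))
        then show "(\<Sum>j<n - 1. map_mat complex_of_real (mat_delete A v v) $$ (i, j) * f (insert_index v j))
            = \<i> * of_real m * f (insert_index v i)"
          unfolding sumn using i by (simp add: entry)
      qed
    qed
    then show "(\<lambda>k. \<i> * complex_of_real (mu k)) ` {1..n - 1}
        \<subseteq> spectrum (map_mat complex_of_real (mat_delete A v v))"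
      by (auto simp: M_def)
  qed
  ultimately show ?thesis by blast
qed

end
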